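(* Let $X$ be a finite set. An operation $\ast\in\mathcal{M}(X)$ is an idempotent element of $\mathcal{M}(X)$ if and only if it acts as $\circ_{lz}$ when restricted to $im(T_\ast)$; in other words, if and only if $T_\ast(a,b)=(a,b)$ for every $(a,b)\in im(T_\ast)$.
   Context: $\mathcal{M}(X)=X^{X\times X}$ is the set of all binary operations on $X$, a monoid under $\triangleright$ defined by $a(\circ\triangleright\ast)b=(a\circ b)\ast(b\circ a)$ for all $a,b\in X$, with identity the left zeros operation $a\circ_{lz}b=a$. An element $\ast\in\mathcal{M}(X)$ is idempotent if $\ast\triangleright\ast=\ast$. The pairmorph transformation of $\ast$ is $T_\ast:X\times X\to X\times X$, $T_\ast(a,b)=(a\ast b,b\ast a)$, and $im(T_\ast)=T_\ast(X\times X)$. *)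

theory Defs
  imports "HOL-Algebra.Group" "HOL-Library.FuncSet"
begin

text \<open>Operations on \<open>X\<close> are extensional functions on \<open>X \<times> X\<close>, so that HOL equality of
  operations is equality as elements of \<open>X\<^bsup>X \<times> X\<^esup>\<close>.\<close>

definition left_zeros :: "'a set \<Rightarrow> 'a \<times> 'a \<Rightarrow> 'a" where
  "left_zeros X = (\<lambda>(a, b) \<in> X \<times> X. a)"

definition binop_mult :: "'a set \<Rightarrow> ('a \<times> 'a \<Rightarrow> 'a) \<Rightarrow> ('a \<times> 'a \<Rightarrow> 'a) \<Rightarrow> 'a \<times> 'a \<Rightarrow> 'a" where
  "binop_mult X f g = (\<lambda>(a, b) \<in> X \<times> X. g (f (a, b), f (b, a)))"

definition binop_monoid :: "'a set \<Rightarrow> ('a \<times> 'a \<Rightarrow> 'a) monoid" where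
  "binop_monoid X = \<lparr>carrier = X \<times> X \<rightarrow>\<^sub>E X, mult = binop_mult X, one = left_zeros X\<rparr>"

definition idempotent_element :: "('b, 'm) monoid_scheme \<Rightarrow> 'b \<Rightarrow> bool" where
  "idempotent_element M x \<longleftrightarrow> x \<in> carrier M \<and> x \<otimes>\<^bsub>M\<^esub> x = x"

definition pairmorph :: "'a set \<Rightarrow> ('a \<times> 'a \<Rightarrow> 'a) \<Rightarrow> 'a \<times> 'a \<Rightarrow> 'a \<times> 'a" where
  "pairmorph X f = (\<lambda>(a, b) \<in> X \<times> X. (f (a, b), f (b, a)))"

definition im_pairmorph :: "'a set \<Rightarrow> ('a \<times> 'a \<Rightarrow> 'a) \<Rightarrow> ('a \<times> 'a) set" where
  "im_pairmorph X f = pairmorph X f ` (X \<times> X)"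

lemma monoid_binop_monoid: "monoid (binop_monoid X)"
proof (rule monoidI)
  fix f g h
  assume "f \<in> carrier (binop_monoid X)" "g \<in> carrier (binop_monoid X)" "h \<in> carrier (binop_monoid X)"
  then show "f \<otimes>\<^bsub>binop_monoid X\<^esub> g \<otimes>\<^bsub>binop_monoid X\<^esub> h = f \<otimes>\<^bsub>binop_monoid X\<^esub> (g \<otimes>\<^bsub>binop_monoid X\<^esub> h)"
    by (auto simp: binop_monoid_def binop_mult_def PiE_iff fun_eq_iff restrict_def)
next
  fix f assume "f \<in> carrier (binop_monoid X)"
  then show "\<one>\<^bsub>binop_monoid X\<^esub> \<otimes>\<^bsub>binop_monoid X\<^esub> f = f"
    by (auto simp: binop_monoid_def binop_mult_def left_zeros_def PiE_iff fun_eq_iff restrict_def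
        extensional_def)
next
  fix f assume "f \<in> carrier (binop_monoid X)"
  then show "f \<otimes>\<^bsub>binop_monoid X\<^esub> \<one>\<^bsub>binop_monoid X\<^esub> = f"
    by (auto simp: binop_monoid_def binop_mult_def left_zeros_def PiE_iff fun_eq_iff restrict_def
        extensional_def)
qed (auto simp: binop_monoid_def binop_mult_def left_zeros_def PiE_iff)

end

theory Submission
  imports Defs
begin

text \<open>Each of the three conditions unfolds to the same identity
  \<open>f (f (a, b), f (b, a)) = f (a, b)\<close> for all a, b in X. Read as an equation of
  operations, it is idempotency (\<open>idempotent_element_binop_iff\<close>); read at the point
  \<open>(f (a, b), f (b, a))\<close> of the image, it says that \<open>f\<close> returns its first
  argument there. The swap of a and b turns it into the second coordinate of the fixed-point
  condition.\<close>

lemma binop_carrier_closed: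
  assumes "f \<in> carrier (binop_monoid X)" "a \<in> X" "b \<in> X"
  shows "f (a, b) \<in> X"
  using assms by (auto simp: binop_monoid_def)

text \<open>Both \<open>f\<close> and its square are extensional on \<open>X \<times> X\<close>, so
  their equality in the monoid is equality at the pairs from X.\<close>

lemma idempotent_element_binop_iff:
  assumes "f \<in> carrier (binop_monoid X)"
  shows "idempotent_element (binop_monoid X) f \<longleftrightarrow>
    (\<forall>a\<in>X. \<forall>b\<in>X. f (f (a, b), f (b, a)) = f (a, b))"
proof -
  have "f \<in> extensional (X \<times> X)"
    using assms by (auto simp: binop_monoid_def PiE_iff)
  moreover have "binop_mult X f f \<in> extensional (X \<times> X)"
    by (simp add: binop_mult_def)
  ultimately have "binop_mult X f f = f \<longleftrightarrow> (\<forall>p\<in>X \<times> X. binop_mult X f f p = f p)"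
    by (auto intro: extensionalityI)
  then show ?thesis
    using assms by (auto simp: idempotent_element_def binop_monoid_def binop_mult_def)
qed

lemma im_pairmorph_eq:
  "im_pairmorph X f = (\<lambda>(a, b). (f (a, b), f (b, a))) ` (X \<times> X)"
  by (auto simp: im_pairmorph_def pairmorph_def)

theorem proposition20:
  fixes X :: "'a set" and f :: "'a \<times> 'a \<Rightarrow> 'a"
  assumes "finite X"
    and "f \<in> carrier (binop_monoid X)"
  shows "(idempotent_element (binop_monoid X) f \<longleftrightarrow>
            restrict f (im_pairmorph X f) = restrict (left_zeros X) (im_pairmorph X f))
       \<and> (idempotent_element (binop_monoid X) f \<longleftrightarrow>
            (\<forall>(a, b) \<in> im_pairmorph X f. pairmorph X f (a, b) = (a, b)))"
proof -
  have restrict_eq_iff: "restrict f A = restrict g A \<longleftrightarrow> (\<forall>p\<in>A. f p = g p)" for g A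
    by (metis restrict_apply' restrict_ext)
  \<comment> \<open>Closure of X under \<open>f\<close> puts the image inside
    \<open>X \<times> X\<close>, where \<open>left_zeros X\<close> is the first projection and not
    \<open>undefined\<close>.\<close>
  have "restrict f (im_pairmorph X f) = restrict (left_zeros X) (im_pairmorph X f) \<longleftrightarrow>
      (\<forall>a\<in>X. \<forall>b\<in>X. f (f (a, b), f (b, a)) = f (a, b))"
    unfolding restrict_eq_iff
    by (simp add: im_pairmorph_eq left_zeros_def binop_carrier_closed[OF assms(2)])
  \<comment> \<open>At the image of (a, b), the first coordinate gives the identity for (a, b) and
    the second gives it for (b, a).\<close>
  moreover have "(\<forall>(a, b) \<in> im_pairmorph X f. pairmorph X f (a, b) = (a, b)) \<longleftrightarrow>
      (\<forall>a\<in>X. \<forall>b\<in>X. f (f (a, b), f (b, a)) = f (a, b))"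
    by (auto simp: im_pairmorph_eq pairmorph_def binop_carrier_closed[OF assms(2)])
  ultimately show ?thesis
    by (simp only: idempotent_element_binop_iff[OF assms(2)])
qed

end
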